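(* Let $\beta>0$ and consider the linear Hamiltonian system $\dot p=-\beta p,\ \dot q=\beta q$ with equilibrium point $(0,0)$. (1) The hyperbolic equilibria structure-preservation region of a symplectic Runge-Kutta (SRK) method $\mathcal{R}_s$ with coefficient matrix $A$ for this system is $$\Big\{h>0:\ \frac{\det(I-zA)}{\det(I+zA)}<1\ \text{ and }\ \frac{\det(I+zA)}{\det(I-zA)}>1,\ z=\beta h\Big\}.$$ (2) If in addition $\mathcal{R}_s$ is A-stable, this region reduces to $$\{h>0:\ \det(I-zA)>0,\ z=\beta h\}.$$ (3) For a symplectic partitioned Runge-Kutta (SPRK) method $\mathcal{R}_s^{(1)}-\mathcal{R}_s^{(2)}$, where $p$ is discretized by $\mathcal{R}_s^{(1)}$ and $q$ by $\mathcal{R}_s^{(2)}$, the hyperbolic structure-preservation region is $$\{h>0:\ R^{(1)}(-z)<1\ \text{ and }\ R^{(2)}(z)>1,\ z=\beta h\},$$ where $R^{(1)}$ and $R^{(2)}$ are the stability functions of $\mathcal{R}_s^{(1)}$ and $\mathcal{R}_s^{(2)}$, respectively.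
   Context: An $s$-stage Runge-Kutta (RK) method $\mathcal{R}_s$ is given by a real $s\times s$ coefficient matrix $A$ and a weight vector $b\in\mathbb{R}^s$ (the abscissae play no role for autonomous systems). It is symplectic (SRK) if $BA+A^TB-bb^T=0$, where $B=\mathrm{diag}[b]$. An $s$-stage partitioned Runge-Kutta method $\mathcal{R}_s^{(1)}-\mathcal{R}_s^{(2)}$ is given by two pairs $(A^{(1)},b^{(1)})$, $(A^{(2)},b^{(2)})$ of the same kind. It is symplectic (SPRK) if $B^{(2)}A^{(1)}+{A^{(2)}}^TB^{(1)}-b^{(2)}{b^{(1)}}^T=0$ with $B^{(i)}=\mathrm{diag}[b^{(i)}]$ $(i=1,2)$, and $b^{(1)}=b^{(2)}$. The stability function of an RK method $(A,b)$ is $R(z)=\det(I-zA+ze_sb^T)/\det(I-zA)$ with $e_s=[1,\ldots,1]^T\in\mathbb{R}^s$; applying the method with step-size $h$ to $y'=\lambda y$ gives $y_{l+1}=R(\lambda h)y_l$. The method is A-stable if $|R(z)|<1$ for all $z\in\mathbb{C}$ with $\Re z<0$. Applied with step-size $h$ to $\dot p=-\beta p,\ \dot q=\beta q$, and with $z=\beta h$, an SRK method with stability function $R$ gives $$\frac{p_{l+1}-p_l}{h}=\frac{R(-z)-1}{h}\,p_l,\qquad \frac{q_{l+1}-q_l}{h}=\frac{R(z)-1}{h}\,q_l,$$ and an SPRK method gives the same with $R(-z)$ replaced by $R^{(1)}(-z)$ and $R(z)$ replaced by $R^{(2)}(z)$. Only step-sizes for which these quantities are defined (denominators nonzero) are considered.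 The stability matrix of the continuous system at $(0,0)$ is $\mathrm{diag}(-\beta,\beta)$, and the system is said to have hyperbolic equilibria structure. The method with step-size $h$ preserves this structure if the stability matrix of the discrete system, i.e. the diagonal coefficient matrix on the right-hand side above, has a negative eigenvalue in the $p$-direction and a positive eigenvalue in the $q$-direction. The hyperbolic (equilibria) structure-preservation region of the method is the set of all step-sizes $h>0$ for which it preserves the structure.
   Formalization: Parts (1) and (2) additionally assume that all weights b_i are nonzero; without this both fail, e.g. for b=(1,0), A=diag(1/2,1/2), which is symplectic and A-stable with true region βh<2, while the stated sets give βh≠2. *)

theory Defs
  imports "HOL-Analysis.Analysis"
begin

text \<open>
  The number of stages is the cardinality of the finite index type \<open>'s\<close>; a method is a pair
  \<open>(A, b)\<close> with \<open>A :: real^'s^'s\<close> and \<open>b :: real^'s\<close>.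
\<close>

definition diag_matrix :: "real^'n \<Rightarrow> real^'n^'n" where
  "diag_matrix v = (\<chi> i j. if i = j then v $ i else 0)"

definition outer_product :: "real^'n \<Rightarrow> real^'n \<Rightarrow> real^'n^'n" where
  "outer_product u v = (\<chi> i j. u $ i * v $ j)"

definition symplectic_rk :: "real^'s^'s \<Rightarrow> real^'s \<Rightarrow> bool" where
  "symplectic_rk A b \<longleftrightarrow>
     diag_matrix b ** A + transpose A ** diag_matrix b - outer_product b b = 0"

text \<open>
  Symplecticity does not exclude vanishing weights. For \<open>b = (1, 0)\<close> and \<open>A = diag(1/2, 1/2)\<close> it
  holds, but \<open>det(I - z A + z e b\<^sup>T) = (1 + z/2) (1 - z/2)\<close> differs from \<open>det(I + z A)\<close>. The two agree
  once all weights are nonzero, i.e. \<open>diag_matrix b\<close> is invertible.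
\<close>

definition symplectic_partitioned_rk ::
    "real^'s^'s \<Rightarrow> real^'s \<Rightarrow> real^'s^'s \<Rightarrow> real^'s \<Rightarrow> bool" where
  "symplectic_partitioned_rk A1 b1 A2 b2 \<longleftrightarrow>
     diag_matrix b2 ** A1 + transpose A2 ** diag_matrix b1 - outer_product b2 b1 = 0 \<and> b1 = b2"

text \<open>
  The stability function \<open>R(z) = det(I - z A + z e b\<^sup>T) / det(I - z A)\<close> with \<open>e = [1,\<dots>,1]\<^sup>T\<close>, so that
  \<open>(e b\<^sup>T)\<^sub>i\<^sub>j = b\<^sub>j\<close>. The argument ranges over an arbitrary \<open>real_field\<close>, because \<open>R\<close> is needed both
  on the complex numbers (A-stability) and on the reals. Since \<open>x / 0 = 0\<close>, the
  nonvanishing of the denominator is always demanded separately where \<open>R\<close> is evaluated.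
\<close>

definition stability_denominator :: "real^'s^'s \<Rightarrow> 'a::real_field \<Rightarrow> 'a" where
  "stability_denominator A z = det (\<chi> i j. (if i = j then 1 else 0) - z * of_real (A $ i $ j))"

definition stability_numerator :: "real^'s^'s \<Rightarrow> real^'s \<Rightarrow> 'a::real_field \<Rightarrow> 'a" where
  "stability_numerator A b z =
     det (\<chi> i j. (if i = j then 1 else 0) - z * of_real (A $ i $ j) + z * of_real (b $ j))"

definition stability_function :: "real^'s^'s \<Rightarrow> real^'s \<Rightarrow> 'a::real_field \<Rightarrow> 'a" where
  "stability_function A b z = stability_numerator A b z / stability_denominator A z"

definition A_stable :: "real^'s^'s \<Rightarrow> real^'s \<Rightarrow> bool" where
  "A_stable A b \<longleftrightarrow>
     (\<forall>z::complex. Re z < 0 \<longrightarrow>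
        stability_denominator A z \<noteq> 0 \<and> norm (stability_function A b z) < 1)"

text \<open>
  The discrete system for \<open>p' = - \<beta> p\<close>, \<open>q' = \<beta> q\<close>, with \<open>(A1, b1)\<close> applied to \<open>p\<close> and \<open>(A2, b2)\<close>
  applied to \<open>q\<close>: the matrix maps \<open>(p\<^sub>l, q\<^sub>l)\<close> to the difference quotients
  \<open>((p\<^sub>l\<^sub>+\<^sub>1 - p\<^sub>l)/h, (q\<^sub>l\<^sub>+\<^sub>1 - q\<^sub>l)/h)\<close>. Component 1 is \<open>p\<close> and component 2 is \<open>q\<close>.
\<close>

definition discrete_stability_matrix ::
    "real \<Rightarrow> real^'s^'s \<Rightarrow> real^'s \<Rightarrow> real^'s^'s \<Rightarrow> real^'s \<Rightarrow> real \<Rightarrow> real^2^2" where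
  "discrete_stability_matrix \<beta> A1 b1 A2 b2 h =
     diag_matrix (vector [(stability_function A1 b1 (- (\<beta> * h)) - 1) / h,
                          (stability_function A2 b2 (\<beta> * h) - 1) / h])"

definition hyperbolic_structure :: "real^2^2 \<Rightarrow> bool" where
  "hyperbolic_structure M \<longleftrightarrow>
     (\<exists>\<mu><0. M *v axis 1 1 = \<mu> *\<^sub>R axis 1 1) \<and>
     (\<exists>\<mu>>0. M *v axis 2 1 = \<mu> *\<^sub>R axis 2 1)"

definition partitioned_preservation_region ::
    "real \<Rightarrow> real^'s^'s \<Rightarrow> real^'s \<Rightarrow> real^'s^'s \<Rightarrow> real^'s \<Rightarrow> real set" where
  "partitioned_preservation_region \<beta> A1 b1 A2 b2 =
     {h. h > 0 \<and>
         stability_denominator A1 (- (\<beta> * h)) \<noteq> 0 \<and>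
         stability_denominator A2 (\<beta> * h) \<noteq> 0 \<and>
         hyperbolic_structure (discrete_stability_matrix \<beta> A1 b1 A2 b2 h)}"

definition preservation_region :: "real \<Rightarrow> real^'s^'s \<Rightarrow> real^'s \<Rightarrow> real set" where
  "preservation_region \<beta> A b = partitioned_preservation_region \<beta> A b A b"

end

theory Submission
  imports Defs
begin

text \<open>
  The difference-quotient matrix is diagonal, so the structure is preserved exactly when
  \<open>(R(-z) - 1) / h < 0\<close> and \<open>(R(z) - 1) / h > 0\<close>; as \<open>h > 0\<close>, this says \<open>R(-z) < 1 < R(z)\<close>
  (\<open>partitioned_preservation_region_eq\<close>). This settles the partitioned case.

  Let \<open>B = diag_matrix b\<close>. If all weights are nonzero, symplecticity \<open>B A + A\<^sup>T B = b b\<^sup>T\<close> together with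
  \<open>B e = b\<close> yields \<open>B (I - z A + z e b\<^sup>T) = (I + z A\<^sup>T) B\<close>. Taking determinants and cancelling
  \<open>det B \<noteq> 0\<close> gives \<open>R(z) = det(I + z A) / det(I - z A)\<close> (\<open>stability_numerator_symplectic\<close>).

  If the method is also A-stable, then \<open>R\<close> has no pole on the negative real axis, hence
  \<open>det(I + z A)\<close> does not vanish for \<open>z > 0\<close>; it equals \<open>1\<close> at \<open>z = 0\<close>, so by continuity it is
  positive for all \<open>z > 0\<close>. Moreover \<open>\<bar>R(-z)\<bar> < 1\<close> means \<open>\<bar>det(I - z A)\<bar> < det(I + z A)\<close>. Thus
  \<open>R(-z) < 1\<close> always holds, and \<open>R(z) > 1\<close> depends only on the sign of \<open>det(I - z A)\<close>.
\<close>

lemma diag_matrix_mult_axis: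
  "diag_matrix v *v axis i 1 = v $ i *\<^sub>R axis i 1"
  unfolding matrix_vector_mult_basis
  by (simp add: vec_eq_iff column_def diag_matrix_def axis_def)

lemma diag_matrix_mult_nth:
  "(diag_matrix v ** M) $ i $ j = v $ i * M $ i $ j"
  "(M ** diag_matrix v) $ i $ j = M $ i $ j * v $ j"
proof -
  have "(diag_matrix v ** M) $ i $ j = (\<Sum>k\<in>UNIV. if i = k then v $ i * M $ k $ j else 0)"
    unfolding matrix_matrix_mult_def diag_matrix_def vec_lambda_beta
    by (intro sum.cong) auto
  then show "(diag_matrix v ** M) $ i $ j = v $ i * M $ i $ j"
    by simp
  have "(M ** diag_matrix v) $ i $ j = (\<Sum>k\<in>UNIV. if k = j then M $ i $ k * v $ k else 0)"
    unfolding matrix_matrix_mult_def diag_matrix_def vec_lambda_beta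
    by (intro sum.cong) auto
  then show "(M ** diag_matrix v) $ i $ j = M $ i $ j * v $ j"
    by simp
qed

lemma hyperbolic_structure_diag_matrix:
  "hyperbolic_structure (diag_matrix (vector [x, y])) \<longleftrightarrow> x < 0 \<and> 0 < y"
  unfolding hyperbolic_structure_def diag_matrix_mult_axis
  by (auto simp: axis_eq_0_iff)

lemma partitioned_preservation_region_eq:
  "partitioned_preservation_region \<beta> A1 b1 A2 b2 =
     {h. h > 0 \<and>
         stability_denominator A1 (- (\<beta> * h)) \<noteq> 0 \<and>
         stability_denominator A2 (\<beta> * h) \<noteq> 0 \<and>
         stability_function A1 b1 (- (\<beta> * h)) < 1 \<and>
         stability_function A2 b2 (\<beta> * h) > 1}"
  unfolding partitioned_preservation_region_def discrete_stability_matrix_def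
    hyperbolic_structure_diag_matrix
  by (auto simp: divide_less_0_iff zero_less_divide_iff)

lemma det_diag_matrix: "det (diag_matrix v) = (\<Prod>i\<in>UNIV. v $ i)"
  by (subst det_diagonal) (auto simp: diag_matrix_def)

lemma stability_denominator_real:
  "stability_denominator A z = det (mat 1 - z *\<^sub>R A)"
  unfolding stability_denominator_def
  by (rule arg_cong[where f = det]) (simp add: vec_eq_iff mat_def)

text \<open>
  Left multiplication by \<open>diag_matrix b\<close> turns the rank-one term \<open>z e b\<^sup>T\<close> of the numerator into
  \<open>z b b\<^sup>T\<close>, where symplecticity applies. Nonzero weights are what makes this multiplication
  reversible.
\<close>

lemma stability_numerator_symplectic:
  fixes A :: "real^'s^'s"
  assumes "symplectic_rk A b" and "\<And>i. b $ i \<noteq> 0"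
  shows "stability_numerator A b z = det (mat 1 + z *\<^sub>R A)"
proof -
  define N :: "real^'s^'s" where
    "N = (\<chi> i j. (if i = j then 1 else 0) - z * A $ i $ j + z * b $ j)"
  have sympl: "b $ i * A $ i $ j + A $ j $ i * b $ j = b $ i * b $ j" for i j
  proof -
    have "(diag_matrix b ** A + transpose A ** diag_matrix b - outer_product b b) $ i $ j = 0"
      using assms(1) by (simp add: symplectic_rk_def)
    then show ?thesis
      by (simp add: diag_matrix_mult_nth outer_product_def transpose_def)
  qed
  have "diag_matrix b ** N = (mat 1 + z *\<^sub>R transpose A) ** diag_matrix b"
  proof -
    have "b $ i * N $ i $ j = ((if i = j then 1 else 0) + z * A $ j $ i) * b $ j" for i j
    proof -
      have "b $ i * N $ i $ j =
          (if i = j then b $ i else 0) - z * (b $ i * A $ i $ j) + z * (b $ i * b $ j)"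
        by (simp add: N_def algebra_simps)
      also have "\<dots> = (if i = j then b $ i else 0) + z * (A $ j $ i * b $ j)"
        unfolding sympl[of i j, symmetric] by (simp add: algebra_simps)
      finally show ?thesis
        by (simp add: algebra_simps)
    qed
    then show ?thesis
      by (simp add: vec_eq_iff diag_matrix_mult_nth transpose_def mat_def)
  qed
  then have "det (diag_matrix b) * det N = det (mat 1 + z *\<^sub>R transpose A) * det (diag_matrix b)"
    by (metis det_mul)
  moreover have "det (diag_matrix b) \<noteq> 0"
    using assms(2) by (simp add: det_diag_matrix)
  moreover have "mat 1 + z *\<^sub>R transpose A = transpose (mat 1 + z *\<^sub>R A)"
    by (simp add: vec_eq_iff transpose_def mat_def)
  ultimately have "det N = det (mat 1 + z *\<^sub>R A)"
    by (simp add: det_transpose)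
  then show ?thesis
    by (simp add: stability_numerator_def N_def)
qed

lemma stability_function_symplectic:
  assumes "symplectic_rk A b" and "\<And>i. b $ i \<noteq> 0"
  shows "stability_function A b z = det (mat 1 + z *\<^sub>R A) / det (mat 1 - z *\<^sub>R A)"
  using assms
  by (simp add: stability_function_def stability_numerator_symplectic stability_denominator_real)

text \<open>
  A-stability speaks about complex arguments, whereas the regions involve real ones. The Leibniz
  formula shows that the determinants commute with the embedding of the reals, so A-stability
  restricts to the negative real axis.
\<close>

lemma det_of_real:
  fixes M :: "real^'n^'n"
  shows "det (\<chi> i j. (of_real (M $ i $ j) :: 'a::real_field)) = of_real (det M)"
  by (simp add: det_def)

lemma stability_denominator_of_real:
  "stability_denominator A (of_real x :: 'a::real_field) = of_real (stability_denominator A x)"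
  unfolding stability_denominator_def
  by (subst det_of_real[symmetric]) (auto intro!: arg_cong[where f = det] simp: vec_eq_iff)

lemma stability_numerator_of_real:
  "stability_numerator A b (of_real x :: 'a::real_field) = of_real (stability_numerator A b x)"
  unfolding stability_numerator_def
  by (subst det_of_real[symmetric]) (auto intro!: arg_cong[where f = det] simp: vec_eq_iff)

lemma A_stable_negative_real:
  fixes x :: real
  assumes "A_stable A b" and "x < 0"
  shows "stability_denominator A x \<noteq> 0" and "\<bar>stability_function A b x\<bar> < 1"
proof -
  have "stability_denominator A (complex_of_real x) \<noteq> 0"
    and "norm (stability_function A b (complex_of_real x)) < 1"
    using assms by (simp_all add: A_stable_def)
  then show "stability_denominator A x \<noteq> 0" and "\<bar>stability_function A b x\<bar> < 1"
    by (simp_all add: stability_function_def stability_denominator_of_real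
        stability_numerator_of_real flip: of_real_divide)
qed

lemma A_stable_det_pos:
  fixes A :: "real^'s^'s"
  assumes "A_stable A b" and "z > 0"
  shows "det (mat 1 + z *\<^sub>R A) > 0"
proof (rule ccontr)
  assume "\<not> ?thesis"
  moreover have "continuous_on {0..z} (\<lambda>t. det (mat 1 + t *\<^sub>R A))"
    unfolding det_def by (intro continuous_intros)
  ultimately obtain t where "0 \<le> t" and root: "det (mat 1 + t *\<^sub>R A) = 0"
    using IVT2'[of "\<lambda>t. det (mat 1 + t *\<^sub>R A)" z 0 0] \<open>z > 0\<close> by auto
  moreover have "t \<noteq> 0"
    using root by auto
  ultimately have "- t < 0" by simp
  from A_stable_negative_real(1)[OF assms(1) this] root show False
    by (simp add: stability_denominator_real)
qed

text \<open>
  Where \<open>det(I - z A) \<noteq> 0\<close>, \<open>R(-z) R(z) = 1\<close>, so \<open>\<bar>R(-z)\<bar> < 1\<close> forces \<open>\<bar>R(z)\<bar> > 1\<close>; only the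
  sign of \<open>R(z)\<close> remains open, and this is the sign of \<open>det(I - z A)\<close>, since \<open>det(I + z A) > 0\<close>.
\<close>

lemma hyperbolic_condition_A_stable:
  assumes "symplectic_rk A b" and "\<And>i. b $ i \<noteq> 0" and "A_stable A b" and "z > 0"
  shows "det (mat 1 + z *\<^sub>R A) \<noteq> 0 \<and> det (mat 1 - z *\<^sub>R A) \<noteq> 0 \<and>
         det (mat 1 - z *\<^sub>R A) / det (mat 1 + z *\<^sub>R A) < 1 \<and>
         det (mat 1 + z *\<^sub>R A) / det (mat 1 - z *\<^sub>R A) > 1 \<longleftrightarrow>
         det (mat 1 - z *\<^sub>R A) > 0"
proof -
  have pos: "det (mat 1 + z *\<^sub>R A) > 0"
    using assms(3,4) by (rule A_stable_det_pos)
  have "\<bar>stability_function A b (- z)\<bar> < 1"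
    using assms(3,4) by (intro A_stable_negative_real) auto
  then have "\<bar>det (mat 1 - z *\<^sub>R A) / det (mat 1 + z *\<^sub>R A)\<bar> < 1"
    using assms(1,2) by (simp add: stability_function_symplectic)
  then have "\<bar>det (mat 1 - z *\<^sub>R A)\<bar> < det (mat 1 + z *\<^sub>R A)"
    using pos by (simp add: abs_divide)
  then show ?thesis
    using pos by (auto simp: less_divide_eq divide_less_eq)
qed

lemma preservation_region_symplectic:
  assumes "symplectic_rk A b" and "\<And>i. b $ i \<noteq> 0"
  shows "preservation_region \<beta> A b =
           {h. h > 0 \<and> (let z = \<beta> * h in
              det (mat 1 + z *\<^sub>R A) \<noteq> 0 \<and> det (mat 1 - z *\<^sub>R A) \<noteq> 0 \<and>
              det (mat 1 - z *\<^sub>R A) / det (mat 1 + z *\<^sub>R A) < 1 \<and>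
              det (mat 1 + z *\<^sub>R A) / det (mat 1 - z *\<^sub>R A) > 1)}"
  using assms
  by (simp add: preservation_region_def partitioned_preservation_region_eq
      stability_function_symplectic stability_denominator_real Let_def)

theorem proposition2p2:
  fixes \<beta> :: real
    and A A1 A2 :: "real^'s^'s"
    and b b1 b2 :: "real^'s"
  assumes "\<beta> > 0"
  shows "(symplectic_rk A b \<and> (\<forall>i. b $ i \<noteq> 0) \<longrightarrow>
            preservation_region \<beta> A b =
              {h. h > 0 \<and> (let z = \<beta> * h in
                 det (mat 1 + z *\<^sub>R A) \<noteq> 0 \<and> det (mat 1 - z *\<^sub>R A) \<noteq> 0 \<and>
                 det (mat 1 - z *\<^sub>R A) / det (mat 1 + z *\<^sub>R A) < 1 \<and>
                 det (mat 1 + z *\<^sub>R A) / det (mat 1 - z *\<^sub>R A) > 1)})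
       \<and> (symplectic_rk A b \<and> (\<forall>i. b $ i \<noteq> 0) \<and> A_stable A b \<longrightarrow>
            preservation_region \<beta> A b =
              {h. h > 0 \<and> (let z = \<beta> * h in det (mat 1 - z *\<^sub>R A) > 0)})
       \<and> (symplectic_partitioned_rk A1 b1 A2 b2 \<longrightarrow>
            partitioned_preservation_region \<beta> A1 b1 A2 b2 =
              {h. h > 0 \<and> (let z = \<beta> * h in
                 stability_denominator A1 (- z) \<noteq> 0 \<and> stability_denominator A2 z \<noteq> 0 \<and>
                 stability_function A1 b1 (- z) < 1 \<and> stability_function A2 b2 z > 1)})"
proof (intro conjI impI; (elim conjE)?)
  assume "symplectic_rk A b" and "\<forall>i. b $ i \<noteq> 0"
  then show "preservation_region \<beta> A b =
              {h. h > 0 \<and> (let z = \<beta> * h in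
                 det (mat 1 + z *\<^sub>R A) \<noteq> 0 \<and> det (mat 1 - z *\<^sub>R A) \<noteq> 0 \<and>
                 det (mat 1 - z *\<^sub>R A) / det (mat 1 + z *\<^sub>R A) < 1 \<and>
                 det (mat 1 + z *\<^sub>R A) / det (mat 1 - z *\<^sub>R A) > 1)}"
    by (intro preservation_region_symplectic) auto
next
  assume sympl: "symplectic_rk A b" and "\<forall>i. b $ i \<noteq> 0" and stable: "A_stable A b"
  then have weights: "\<And>i. b $ i \<noteq> 0"
    by blast
  show "preservation_region \<beta> A b =
              {h. h > 0 \<and> (let z = \<beta> * h in det (mat 1 - z *\<^sub>R A) > 0)}"
    unfolding preservation_region_symplectic[OF sympl weights] Let_def
    using assms
    by (intro Collect_cong conj_cong refl hyperbolic_condition_A_stable[OF sympl weights stable])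
      simp
next
  show "partitioned_preservation_region \<beta> A1 b1 A2 b2 =
              {h. h > 0 \<and> (let z = \<beta> * h in
                 stability_denominator A1 (- z) \<noteq> 0 \<and> stability_denominator A2 z \<noteq> 0 \<and>
                 stability_function A1 b1 (- z) < 1 \<and> stability_function A2 b2 z > 1)}"
    by (simp add: partitioned_preservation_region_eq Let_def)
qed

end
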